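(* If $a \in \mathbb{Q}$ and there exists a positive integer $n$ such that $B_n(a) = 0$, then $a \in \{0, -1, -\frac{1}{2}, -\frac{1}{3}\}$.
   Context: The Stern polynomials $B_n(t) \in \mathbb{Z}[t]$, $n \geq 0$, are defined by $B_0(t) = 0$, $B_1(t) = 1$, and for $n \geq 2$: $B_n(t) = t\,B_{n/2}(t)$ if $n$ is even, and $B_n(t) = B_{(n+1)/2}(t) + B_{(n-1)/2}(t)$ if $n$ is odd. *)

theory Defs
  imports "HOL-Computational_Algebra.Polynomial"
begin

function stern_poly :: "nat \<Rightarrow> int poly" where
  "stern_poly n =
     (if n = 0 then 0
      else if n = 1 then 1
      else if even n then [:0, 1:] * stern_poly (n div 2)
      else stern_poly ((n + 1) div 2) + stern_poly ((n - 1) div 2))"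
  by auto
termination
proof (relation "measure (\<lambda>n. n)", goal_cases)
  case (3 n)
  then have "n \<ge> 2" by simp
  moreover from this 3 have "n \<noteq> 2" by auto
  ultimately show ?case by simp
qed auto

(* The defining equation is unconditional, so as a simp rule it could unfold forever. *)
declare stern_poly.simps [simp del]

lemma stern_poly_0: "stern_poly 0 = 0"
  and stern_poly_1: "stern_poly 1 = 1"
  and stern_poly_even: "n \<ge> 2 \<Longrightarrow> even n \<Longrightarrow> stern_poly n = [:0, 1:] * stern_poly (n div 2)"
  and stern_poly_odd: "n \<ge> 2 \<Longrightarrow> odd n \<Longrightarrow>
         stern_poly n = stern_poly ((n + 1) div 2) + stern_poly ((n - 1) div 2)"
  by (subst stern_poly.simps; simp)+

end

theory Submission
  imports Defs
begin

text \<open>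
  If \<open>(x, y) = (B\<^sub>n(t), B\<^sub>n\<^sub>+\<^sub>1(t))\<close>, then the consecutive pairs of values at the positions \<open>2n\<close>
  and \<open>2n + 1\<close> are \<open>(t x, x + y)\<close> and \<open>(x + y, t y)\<close>. Statements about neighbouring values
  can therefore be proved by binary induction on the position, and three of them confine the
  rational roots.

  The polynomials of odd index have constant term \<open>1\<close>, because in \<open>x + y\<close> exactly one of the two
  summands has an odd index and the other one vanishes at \<open>0\<close>. Hence the reversed polynomial is
  monic, and the inverse of a nonzero rational root of an odd-indexed \<open>B\<^sub>n\<close> is an integer. All
  values at a positive \<open>t\<close> are positive, so that integer is negative. Finally, for
  \<open>\<bar>t\<bar> \<le> 1/4\<close> an even-indexed value is at most half as large as either of its odd-indexed
  neighbours; the two summands \<open>x\<close>, \<open>y\<close> of the next odd-indexed value then cannot cancel, so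
  it is nonzero. A nonzero root of an odd-indexed \<open>B\<^sub>n\<close> is therefore \<open>-1/m\<close> with \<open>m \<le> 3\<close>.
  An even-indexed \<open>B\<^sub>n\<close> has the same nonzero roots as \<open>B\<close> at the odd part of \<open>n\<close>.
\<close>

section \<open>Values of Stern polynomials\<close>

definition stern_value :: "nat \<Rightarrow> 'a::comm_ring_1 \<Rightarrow> 'a" where
  "stern_value n x = poly (map_poly of_int (stern_poly n)) x"

lemma stern_value_0 [simp]: "stern_value 0 x = 0"
  by (simp add: stern_value_def stern_poly_0)

lemma stern_value_1 [simp]: "stern_value (Suc 0) x = 1"
  using stern_poly_1 by (simp add: stern_value_def)

lemma stern_value_double: "stern_value (2 * n) x = x * stern_value n x"
proof (cases "n = 0")
  case False
  then have "stern_poly (2 * n) = pCons 0 (stern_poly n)"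
    by (simp add: stern_poly_even)
  then show ?thesis
    by (simp add: stern_value_def map_poly_pCons)
qed simp

lemma stern_value_double_plus_1:
  "stern_value (Suc (2 * n)) x = stern_value n x + stern_value (Suc n) x"
proof (cases "n = 0")
  case False
  then have "stern_poly (Suc (2 * n)) = stern_poly n + stern_poly (Suc n)"
    by (simp add: stern_poly_odd)
  moreover have "map_poly of_int (p + q) = (map_poly of_int p + map_poly of_int q :: 'a poly)"
    for p q :: "int poly"
    by (intro poly_eqI) (simp add: coeff_map_poly)
  ultimately show ?thesis
    by (simp add: stern_value_def)
qed simp

section \<open>Positive arguments\<close>

lemma stern_value_pos:
  fixes x :: "'a::linordered_idom"
  assumes "x > 0" "n > 0"
  shows "stern_value n x > 0"
proof -
  have "stern_value n x \<ge> 0 \<and> stern_value (Suc n) x > 0 \<and> (n > 0 \<longrightarrow> stern_value n x > 0)"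
  proof (induction n rule: nat_bit_induct)
    case (odd n)
    then show ?case
      using \<open>x > 0\<close> stern_value_double[of "Suc n" x]
      by (auto simp: stern_value_double_plus_1)
  qed (use \<open>x > 0\<close> in \<open>auto simp: stern_value_double stern_value_double_plus_1\<close>)
  with \<open>n > 0\<close> show ?thesis by simp
qed

section \<open>Small arguments\<close>

text \<open>
  The bound one half is preserved because the sum of an odd-indexed value \<open>v\<close> and its
  even-indexed neighbour is at least \<open>\<bar>v\<bar> / 2\<close> in absolute value, while the even-indexed
  values next to that sum are at most \<open>\<bar>v\<bar> / 4\<close>. With a ratio \<open>c\<close> in place of one half the
  argument would require \<open>\<bar>x\<bar> \<le> c (1 - c)\<close>, and \<open>c = 1/2\<close> makes this least restrictive.
\<close>

lemma stern_value_even_dominated: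
  fixes x :: "'a::linordered_field"
  assumes "\<bar>x\<bar> \<le> 1 / 4"
  defines "dominated \<equiv> \<lambda>u v::'a. v \<noteq> 0 \<and> 2 * \<bar>u\<bar> \<le> \<bar>v\<bar>"
  shows "if even n then dominated (stern_value n x) (stern_value (Suc n) x)
         else dominated (stern_value (Suc n) x) (stern_value n x)"
proof -
  have small: "4 * \<bar>x * w\<bar> \<le> \<bar>w\<bar>" for w
    using mult_right_mono[OF assms(1), of "\<bar>w\<bar>"] by (simp add: abs_mult)
  have step: "dominated (x * u) (u + v)" "dominated (x * v) (u + v)"
    if "dominated u v" for u v
    using that small[of u] small[of v] unfolding dominated_def by linarith+
  have step': "dominated (x * u) (u + v)" "dominated (x * v) (u + v)"
    if "dominated v u" for u v
    using step[OF that] by (simp_all add: add.commute)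
  show ?thesis
  proof (induction n rule: nat_bit_induct)
    case zero
    show ?case by (simp add: dominated_def)
  next
    case (even n)
    then show ?case
      by (auto simp: stern_value_double stern_value_double_plus_1 step step' split: if_splits)
  next
    case (odd n)
    then show ?case
      using stern_value_double[of "Suc n" x]
      by (auto simp: stern_value_double_plus_1 step step' split: if_splits)
  qed
qed

corollary stern_value_odd_nonzero:
  fixes x :: "'a::linordered_field"
  assumes "odd n" "\<bar>x\<bar> \<le> 1 / 4"
  shows "stern_value n x \<noteq> 0"
  using stern_value_even_dominated[OF assms(2), of n] assms(1) by simp

section \<open>Rational roots\<close>

lemma stern_value_at_0: "stern_value n 0 = (of_bool (odd n) :: 'a::comm_ring_1)"
proof -
  have "stern_value n 0 = (of_bool (odd n) :: 'a) \<and>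
        stern_value (Suc n) 0 = (of_bool (even n) :: 'a)"
  proof (induction n rule: nat_bit_induct)
    case (odd n)
    then show ?case
      using stern_value_double[of "Suc n" "0::'a"]
      by (auto simp: stern_value_double_plus_1)
  qed (auto simp: stern_value_double stern_value_double_plus_1)
  then show ?thesis by simp
qed

lemma inverse_stern_root_in_Ints:
  fixes a :: rat
  assumes "odd n" "stern_value n a = 0"
  shows "inverse a \<in> \<int>"
proof (rule rational_algebraic_int_is_int)
  show "inverse a \<in> \<rat>"
    by (metis Rats_of_rat of_rat_eq_id id_apply)
  show "algebraic_int (inverse a)"
  proof (rule algebraic_int_inverse)
    let ?p = "map_poly of_int (stern_poly n) :: rat poly"
    show "poly ?p a = 0"
      using assms(2) by (simp add: stern_value_def)
    show "\<forall>i. coeff ?p i \<in> \<int>"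
      by (simp add: coeff_map_poly)
    show "coeff ?p 0 = 1"
      using stern_value_at_0[of n, where 'a = rat] assms(1)
      by (simp add: stern_value_def poly_0_coeff_0)
  qed
qed

text \<open>
  Since \<open>B\<^sub>2\<^sub>n(a) = a B\<^sub>n(a)\<close>, halving an even index keeps a nonzero root, and
  the descent ends at an odd index.
\<close>

lemma stern_root_odd_index:
  fixes a :: "'a::idom"
  assumes "n > 0" "stern_value n a = 0" "a \<noteq> 0"
  obtains m where "odd m" "stern_value m a = 0"
proof -
  have "\<exists>m. odd m \<and> stern_value m a = 0"
    using assms(1,2)
  proof (induction n rule: nat_bit_induct)
    case (even n)
    then show ?case
      using \<open>a \<noteq> 0\<close> by (simp add: stern_value_double)
  next
    case (odd n)
    then show ?case
      by (intro exI[of _ "Suc (2 * n)"]) simp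
  qed simp
  then show ?thesis using that by blast
qed

theorem theorem2p1:
  fixes a :: rat
  assumes "\<exists>n::nat. n > 0 \<and> poly (map_poly of_int (stern_poly n)) a = 0"
  shows "a \<in> {0, -1, -1/2, -1/3}"
proof (cases "a = 0")
  case False
  from assms obtain n where n: "n > 0" "stern_value n a = 0"
    by (auto simp: stern_value_def)
  obtain m where m: "odd m" "stern_value m a = 0"
    using stern_root_odd_index[OF n False] .
  have "a < 0"
    using stern_value_pos[of a n] n False by fastforce
  have "- a > 1 / 4"
    using stern_value_odd_nonzero[of m a] m \<open>a < 0\<close> by fastforce
  obtain k where k: "inverse a = of_int k"
    using inverse_stern_root_in_Ints[OF m] by (elim Ints_cases)
  then have a: "a = 1 / of_int k"
    by (metis inverse_eq_divide inverse_inverse_eq)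
  have "k < 0"
    using \<open>a < 0\<close> by (simp add: a)
  moreover have "k > -4"
    using \<open>- a > 1 / 4\<close> \<open>k < 0\<close> by (simp add: a field_simps)
  ultimately have "k \<in> {-1, -2, -3}" by auto
  with a show ?thesis by auto
qed simp

end
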